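(* Let $G$ and $H$ be arbitrary connected graphs. Then (i) $\chi_{2}^{f}(G\boxtimes H)\le \min\{\chi_2(G)\chi_{2}^{f}(H),\ \chi_2(H)\chi_{2}^{f}(G)\}$, and (ii) $\chi_{2}^{f}(G\times H)\le \min\{\chi_{i}(G)\chi_{2}^{f}(H),\ \chi_{i}(H)\chi_{2}^{f}(G)\}$. These bounds are sharp, i.e., each of (i) and (ii) is attained with equality for some connected $G$ and $H$.
   Context: All graphs are finite and simple, with nonempty vertex set. The products below have vertex set $V(G)\times V(H)$. In the direct product $G\times H$, two vertices are adjacent if they are adjacent in both coordinates. In the Cartesian product $G\,\square\,H$, two vertices are adjacent if they are adjacent in one coordinate and equal in the other. The strong product $G\boxtimes H$ has edge set $E(G\,\square\, H)\cup E(G\times H)$. A $2$-frugal coloring of a graph is a proper vertex coloring in which no color appears more than twice in the (open) neighborhood of any vertex; $\chi_2^f(G)$ is the minimum number of colors in such a coloring. A $2$-distance coloring of $G$ is a vertex coloring in which any two distinct vertices at distance at most $2$ receive different colors; $\chi_2(G)$ is the minimum number of colors in such a coloring. An injective coloring of $G$ is a (not necessarily proper) vertex coloring $f$ such that no vertex $v$ is adjacent to two distinct vertices $u,w$ with $f(u)=f(w)$; the injective chromatic number $\chi_i(G)$ is the minimum number of colors in such a coloring. *)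

theory Defs
  imports "Graph_Theory.Graph_Theory"
begin

(* Finite simple graphs are rendered by the locale predicate pair_graph: an edge {u,v} is the pair
   of arcs (u,v), (v,u). The predicate Digraph_Component.connected entails a nonempty vertex set. *)

definition direct_edges ::
    "'a pair_pre_digraph \<Rightarrow> 'b pair_pre_digraph \<Rightarrow> ('a \<times> 'b) rel" where
  "direct_edges G H =
     {((g, h), (g', h')) | g h g' h'. (g, g') \<in> parcs G \<and> (h, h') \<in> parcs H}"

definition cartesian_edges ::
    "'a pair_pre_digraph \<Rightarrow> 'b pair_pre_digraph \<Rightarrow> ('a \<times> 'b) rel" where
  "cartesian_edges G H =
     {((g, h), (g', h')) | g h g' h'.
        (g, g') \<in> parcs G \<and> h = h' \<and> h \<in> pverts H \<or>
        g = g' \<and> g \<in> pverts G \<and> (h, h') \<in> parcs H}"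

definition direct_product ::
    "'a pair_pre_digraph \<Rightarrow> 'b pair_pre_digraph \<Rightarrow> ('a \<times> 'b) pair_pre_digraph" where
  "direct_product G H = \<lparr> pverts = pverts G \<times> pverts H, parcs = direct_edges G H \<rparr>"

definition strong_product ::
    "'a pair_pre_digraph \<Rightarrow> 'b pair_pre_digraph \<Rightarrow> ('a \<times> 'b) pair_pre_digraph" where
  "strong_product G H =
     \<lparr> pverts = pverts G \<times> pverts H, parcs = cartesian_edges G H \<union> direct_edges G H \<rparr>"

definition neighborhood :: "'a pair_pre_digraph \<Rightarrow> 'a \<Rightarrow> 'a set" where
  "neighborhood G v = {u. (v, u) \<in> parcs G}"

(* The infimum of the lengths of the walks from u to v: infinite if there is none. *)
definition graph_dist :: "'a pair_pre_digraph \<Rightarrow> 'a \<Rightarrow> 'a \<Rightarrow> ereal" where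
  "graph_dist G u v = wf_digraph.\<mu> (with_proj G) (\<lambda>_. 1) u v"

definition proper_coloring :: "'a pair_pre_digraph \<Rightarrow> ('a \<Rightarrow> 'c) \<Rightarrow> bool" where
  "proper_coloring G f \<longleftrightarrow> (\<forall>u v. (u, v) \<in> parcs G \<longrightarrow> f u \<noteq> f v)"

definition two_frugal_coloring :: "'a pair_pre_digraph \<Rightarrow> ('a \<Rightarrow> 'c) \<Rightarrow> bool" where
  "two_frugal_coloring G f \<longleftrightarrow>
     proper_coloring G f \<and>
     (\<forall>v \<in> pverts G. \<forall>c. card {u \<in> neighborhood G v. f u = c} \<le> 2)"

definition two_distance_coloring :: "'a pair_pre_digraph \<Rightarrow> ('a \<Rightarrow> 'c) \<Rightarrow> bool" where
  "two_distance_coloring G f \<longleftrightarrow>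
     (\<forall>u \<in> pverts G. \<forall>v \<in> pverts G. u \<noteq> v \<and> graph_dist G u v \<le> 2 \<longrightarrow> f u \<noteq> f v)"

definition injective_coloring :: "'a pair_pre_digraph \<Rightarrow> ('a \<Rightarrow> 'c) \<Rightarrow> bool" where
  "injective_coloring G f \<longleftrightarrow> (\<forall>v \<in> pverts G. inj_on f (neighborhood G v))"

(* Colors are natural numbers, which loses nothing since the vertex sets are finite. *)
definition min_colors :: "'a pair_pre_digraph \<Rightarrow> (('a \<Rightarrow> nat) \<Rightarrow> bool) \<Rightarrow> nat" where
  "min_colors G P = (LEAST k. \<exists>f. P f \<and> card (f ` pverts G) = k)"

definition chi_2f :: "'a pair_pre_digraph \<Rightarrow> nat" where
  "chi_2f G = min_colors G (two_frugal_coloring G)"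

definition chi_2 :: "'a pair_pre_digraph \<Rightarrow> nat" where
  "chi_2 G = min_colors G (two_distance_coloring G)"

definition chi_i :: "'a pair_pre_digraph \<Rightarrow> nat" where
  "chi_i G = min_colors G (injective_coloring G)"

definition connected_graph :: "'a pair_pre_digraph \<Rightarrow> bool" where
  "connected_graph G \<longleftrightarrow> pair_graph G \<and> Digraph_Component.connected (with_proj G)"

end

theory Submission
  imports Defs
begin

text \<open>
  Both bounds come from colouring the vertex \<open>(u, v)\<close> of a product with the pair
  \<open>(f u, g v)\<close>, where \<open>g\<close> is an optimal 2-frugal colouring of the second factor and \<open>f\<close> is
  an optimal colouring of the first factor that is injective on every closed neighborhood (a
  2-distance colouring, for the strong product) or on every open neighborhood (an injective
  colouring, for the direct product). The neighbours of \<open>(u, v)\<close> with a given colour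
  \<open>(a, b)\<close> then all have the same first coordinate, because \<open>f\<close> separates the possible first
  coordinates. Their second coordinates lie in the closed neighborhood of \<open>v\<close> and have colour
  \<open>b\<close>; there are at most two such vertices, since either \<open>b = g v\<close>, which leaves only \<open>v\<close>
  because \<open>g\<close> is proper, or only the open neighborhood matters and \<open>g\<close> is 2-frugal. This
  count is common to the two products (\<open>chi_2f_product_le\<close>). The other half of each minimum
  follows because exchanging the coordinates embeds each product into the product with
  exchanged factors.

  Both bounds are attained at \<open>G = H = K\<^sub>2\<close>. The strong product is \<open>K\<^sub>4\<close>, which needs
  \<open>4 = 2 * 2\<close> colours. The direct product consists of two disjoint edges and needs two
  colours, while \<open>\<chi>\<^sub>i(K\<^sub>2) = 1\<close> and \<open>\<chi>\<^sub>2\<^sup>f(K\<^sub>2) = 2\<close>.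
\<close>

section \<open>Optimal colourings\<close>

lemma min_colors_le: "P f \<Longrightarrow> min_colors G P \<le> card (f ` pverts G)"
  unfolding min_colors_def by (rule Least_le) blast

lemma min_colors_attained:
  assumes "P f"
  obtains g where "P g" "card (g ` pverts G) = min_colors G P"
proof -
  have "\<exists>k g. P g \<and> card (g ` pverts G) = k"
    using assms by blast
  then have "\<exists>g. P g \<and> card (g ` pverts G) = min_colors G P"
    unfolding min_colors_def by (rule LeastI_ex)
  then show ?thesis
    using that by blast
qed

lemma finite_neighborhood:
  assumes "pair_graph G"
  shows "finite (neighborhood G v)"
proof -
  interpret pair_graph G by fact
  have "neighborhood G v \<subseteq> pverts G"
    unfolding neighborhood_def using in_arcsD2 by blast
  then show ?thesis
    using pair_finite_verts by (rule finite_subset)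
qed

lemma two_frugal_coloring_if_inj:
  assumes "pair_graph G" "inj_on f (pverts G)"
  shows "two_frugal_coloring G f"
proof -
  interpret pair_graph G by fact
  have "card {u \<in> neighborhood G v. f u = c} \<le> 1" for v c
  proof (rule card_le_Suc0_iff_eq[THEN iffD2, folded One_nat_def])
    show "finite {u \<in> neighborhood G v. f u = c}"
      using finite_neighborhood[OF assms(1)] by simp
    show "\<forall>a\<in>{u \<in> neighborhood G v. f u = c}. \<forall>b\<in>{u \<in> neighborhood G v. f u = c}. a = b"
      using assms(2) in_arcsD2 by (auto simp: neighborhood_def inj_on_def)
  qed
  then have "card {u \<in> neighborhood G v. f u = c} \<le> 2" for v c
    by (meson le_trans one_le_numeral)
  moreover have "f u \<noteq> f v" if "(u, v) \<in> parcs G" for u v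
    using that pair_no_loops[OF that] in_arcsD1 in_arcsD2 assms(2) by (auto simp: inj_on_def)
  ultimately show ?thesis
    by (auto simp: two_frugal_coloring_def proper_coloring_def)
qed

lemma two_distance_coloring_if_inj:
  "inj_on f (pverts G) \<Longrightarrow> two_distance_coloring G f"
  by (auto simp: two_distance_coloring_def inj_on_def)

lemma injective_coloring_if_inj:
  assumes "pair_graph G" "inj_on f (pverts G)"
  shows "injective_coloring G f"
proof -
  interpret pair_graph G by fact
  show ?thesis
    using assms(2) in_arcsD2 by (auto simp: injective_coloring_def neighborhood_def inj_on_def)
qed

lemma inj_coloring_exists:
  assumes "pair_graph G"
  obtains e :: "_ \<Rightarrow> nat" where "inj_on e (pverts G)"
proof -
  interpret pair_graph G by fact
  show ?thesis
    using that finite_imp_inj_to_nat_seg[OF pair_finite_verts] by blast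
qed

lemma optimal_two_frugal_coloring:
  assumes "pair_graph G"
  obtains f :: "_ \<Rightarrow> nat" where "two_frugal_coloring G f" "card (f ` pverts G) = chi_2f G"
proof -
  obtain e :: "_ \<Rightarrow> nat" where e: "inj_on e (pverts G)"
    using assms by (rule inj_coloring_exists)
  show ?thesis
    using that unfolding chi_2f_def
    by (rule min_colors_attained[of "two_frugal_coloring G", OF two_frugal_coloring_if_inj[OF assms e]])
qed

lemma optimal_two_distance_coloring:
  assumes "pair_graph G"
  obtains f :: "_ \<Rightarrow> nat" where "two_distance_coloring G f" "card (f ` pverts G) = chi_2 G"
proof -
  obtain e :: "_ \<Rightarrow> nat" where e: "inj_on e (pverts G)"
    using assms by (rule inj_coloring_exists)
  show ?thesis
    using that unfolding chi_2_def
    by (rule min_colors_attained[of "two_distance_coloring G", OF two_distance_coloring_if_inj[OF e]])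
qed

lemma optimal_injective_coloring:
  assumes "pair_graph G"
  obtains f :: "_ \<Rightarrow> nat" where "injective_coloring G f" "card (f ` pverts G) = chi_i G"
proof -
  obtain e :: "_ \<Rightarrow> nat" where e: "inj_on e (pverts G)"
    using assms by (rule inj_coloring_exists)
  show ?thesis
    using that unfolding chi_i_def
    by (rule min_colors_attained[of "injective_coloring G", OF injective_coloring_if_inj[OF assms e]])
qed

section \<open>Pair colourings of products\<close>

text \<open>
  In a proper colouring the colour of \<open>v\<close> is absent from its neighborhood, so adding \<open>v\<close>
  to its neighborhood creates a colour class of size one and changes no other class.
\<close>

lemma two_frugal_closed_neighborhood:
  assumes "two_frugal_coloring G f" "v \<in> pverts G"
  shows "card {u \<in> insert v (neighborhood G v). f u = c} \<le> 2"
proof (cases "c = f v")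
  case True
  moreover have "f u \<noteq> f v" if "u \<in> neighborhood G v" for u
    using assms(1) that
    by (metis mem_Collect_eq neighborhood_def proper_coloring_def two_frugal_coloring_def)
  ultimately have "{u \<in> insert v (neighborhood G v). f u = c} = {v}"
    by auto
  then show ?thesis
    by simp
next
  case False
  then have "{u \<in> insert v (neighborhood G v). f u = c} = {u \<in> neighborhood G v. f u = c}"
    by auto
  then show ?thesis
    using assms by (simp add: two_frugal_coloring_def)
qed

text \<open>
  The set \<open>S u\<close> stands for the open neighborhood of \<open>u\<close> in the case of the direct product
  and for the closed one in the case of the strong product.
\<close>

lemma chi_2f_product_le:
  fixes f :: "'a \<Rightarrow> nat" and g :: "'b \<Rightarrow> nat"
  assumes "finite (pverts G)" "pair_graph H"
    and verts: "pverts D = pverts G \<times> pverts H"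
    and arcs: "\<And>u v u' v'. ((u, v), (u', v')) \<in> parcs D \<Longrightarrow>
      u' \<in> S u \<and> v' \<in> insert v (neighborhood H v) \<and> (f u, g v) \<noteq> (f u', g v')"
    and inj: "\<And>u. u \<in> pverts G \<Longrightarrow> inj_on f (S u)"
    and frugal: "two_frugal_coloring H g"
  shows "chi_2f D \<le> card (f ` pverts G) * card (g ` pverts H)"
proof -
  interpret H: pair_graph H by fact
  define h where "h = (\<lambda>(u, v). prod_encode (f u, g v))"
  have "card {x \<in> neighborhood D (u, v). h x = c} \<le> 2"
    if u: "u \<in> pverts G" and v: "v \<in> pverts H" for u v c
  proof -
    obtain a b where c: "c = prod_encode (a, b)"
      by (metis prod_decode_inverse surj_pair)
    let ?N = "{x \<in> neighborhood D (u, v). h x = c}"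
    let ?W = "{w \<in> insert v (neighborhood H v). g w = b}"
    have mem: "u' \<in> S u \<and> f u' = a \<and> v' \<in> ?W" if "(u', v') \<in> ?N" for u' v'
      using that arcs[of u v u' v'] by (auto simp: neighborhood_def h_def c)
    then have "inj_on snd ?N"
      using inj[OF u] by (intro inj_onI) (metis (no_types, lifting) inj_onD prod.collapse)
    moreover have "snd ` ?N \<subseteq> ?W"
      using mem by force
    moreover have "finite ?W"
      using finite_neighborhood[OF assms(2)] by simp
    ultimately have "card ?N \<le> card ?W"
      by (rule card_inj_on_le)
    also have "\<dots> \<le> 2"
      using two_frugal_closed_neighborhood[OF frugal v] .
    finally show ?thesis .
  qed
  moreover have "proper_coloring D h"
    using arcs by (fastforce simp: proper_coloring_def h_def)
  ultimately have "two_frugal_coloring D h"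
    using verts by (auto simp: two_frugal_coloring_def)
  then have "chi_2f D \<le> card (h ` pverts D)"
    unfolding chi_2f_def by (rule min_colors_le)
  also have "\<dots> \<le> card (prod_encode ` (f ` pverts G \<times> g ` pverts H))"
    using assms(1) H.pair_finite_verts by (intro card_mono) (auto simp: h_def verts)
  also have "\<dots> = card (f ` pverts G) * card (g ` pverts H)"
    by (simp add: card_image inj_prod_encode card_cartesian_product)
  finally show ?thesis .
qed

lemma graph_dist_le_walk:
  assumes "pair_graph G" "pre_digraph.awalk (with_proj G) u p v"
  shows "graph_dist G u v \<le> length p"
proof -
  interpret pair_graph G by fact
  have "awalk_cost (\<lambda>_. 1) p = length p"
    by (simp add: awalk_cost_def sum_list_triv)
  then show ?thesis
    unfolding graph_dist_def using min_cost_le_walk_cost[OF assms(2), of "\<lambda>_. 1"] by simp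
qed

text \<open>
  Any two vertices of a closed neighborhood are joined by a walk of length at most two
  through its centre.
\<close>

lemma two_distance_coloring_inj_closed_neighborhood:
  assumes "pair_graph G" "two_distance_coloring G f" "u \<in> pverts G"
  shows "inj_on f (insert u (neighborhood G u))"
proof (rule inj_onI, rule ccontr)
  interpret pair_graph G by fact
  fix x y
  assume x: "x \<in> insert u (neighborhood G u)" and y: "y \<in> insert u (neighborhood G u)"
    and eq: "f x = f y" and "x \<noteq> y"
  obtain p where p: "awalk x p u" "length p \<le> 1"
  proof (cases "x = u")
    case True
    then show ?thesis
      using that[of "[]"] assms(3) by (simp add: awalk_simps)
  next
    case False
    then have "(x, u) \<in> parcs G"
      using x arcs_symmetric[of u x] by (auto simp: neighborhood_def)
    then show ?thesis
      using that[of "[(x, u)]"] assms(3) in_arcsD1 by (simp add: awalk_simps)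
  qed
  obtain q where q: "awalk u q y" "length q \<le> 1"
  proof (cases "y = u")
    case True
    then show ?thesis
      using that[of "[]"] assms(3) by (simp add: awalk_simps)
  next
    case False
    then have "(u, y) \<in> parcs G"
      using y by (auto simp: neighborhood_def)
    then show ?thesis
      using that[of "[(u, y)]"] assms(3) in_arcsD2 by (simp add: awalk_simps)
  qed
  have walk: "awalk x (p @ q) y"
    using p(1) q(1) by (rule awalk_appendI)
  have "graph_dist G x y \<le> length (p @ q)"
    using graph_dist_le_walk[OF assms(1) walk] .
  also have "ereal (length (p @ q)) \<le> 2"
    using p(2) q(2) by simp
  finally have "f x \<noteq> f y"
    using assms(2) \<open>x \<noteq> y\<close> walk unfolding two_distance_coloring_def by blast
  then show False
    using eq by contradiction
qed

lemma chi_2f_strong_product_le: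
  assumes "pair_graph G" "pair_graph H"
  shows "chi_2f (strong_product G H) \<le> chi_2 G * chi_2f H"
proof -
  interpret G: pair_graph G by fact
  obtain f :: "_ \<Rightarrow> nat" where f: "two_distance_coloring G f" "card (f ` pverts G) = chi_2 G"
    using assms(1) by (rule optimal_two_distance_coloring)
  obtain g :: "_ \<Rightarrow> nat" where g: "two_frugal_coloring H g" "card (g ` pverts H) = chi_2f H"
    using assms(2) by (rule optimal_two_frugal_coloring)
  note inj = two_distance_coloring_inj_closed_neighborhood[OF assms(1) f(1)]
  have "f u \<noteq> f u'" if "(u, u') \<in> parcs G" for u u'
    using inj[of u] that G.pair_no_loops[OF that] G.in_arcsD1
    by (auto simp: neighborhood_def inj_on_def)
  then have proper: "(f u, g v) \<noteq> (f u', g v')"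
    if "((u, v), (u', v')) \<in> parcs (strong_product G H)" for u v u' v'
    using that g(1) unfolding two_frugal_coloring_def proper_coloring_def
    by (fastforce simp: strong_product_def cartesian_edges_def direct_edges_def)
  have "chi_2f (strong_product G H) \<le> card (f ` pverts G) * card (g ` pverts H)"
  proof (rule chi_2f_product_le)
    show "u' \<in> insert u (neighborhood G u) \<and> v' \<in> insert v (neighborhood H v) \<and>
        (f u, g v) \<noteq> (f u', g v')"
      if "((u, v), (u', v')) \<in> parcs (strong_product G H)" for u v u' v'
      using that proper[OF that]
      by (auto simp: strong_product_def cartesian_edges_def direct_edges_def neighborhood_def)
  qed (use inj g(1) assms(2) G.pair_finite_verts in \<open>simp_all add: strong_product_def\<close>)
  then show ?thesis
    using f(2) g(2) by simp
qed

lemma chi_2f_direct_product_le: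
  assumes "pair_graph G" "pair_graph H"
  shows "chi_2f (direct_product G H) \<le> chi_i G * chi_2f H"
proof -
  interpret G: pair_graph G by fact
  obtain f :: "_ \<Rightarrow> nat" where f: "injective_coloring G f" "card (f ` pverts G) = chi_i G"
    using assms(1) by (rule optimal_injective_coloring)
  obtain g :: "_ \<Rightarrow> nat" where g: "two_frugal_coloring H g" "card (g ` pverts H) = chi_2f H"
    using assms(2) by (rule optimal_two_frugal_coloring)
  have "chi_2f (direct_product G H) \<le> card (f ` pverts G) * card (g ` pverts H)"
  proof (rule chi_2f_product_le)
    show "u' \<in> neighborhood G u \<and> v' \<in> insert v (neighborhood H v) \<and>
        (f u, g v) \<noteq> (f u', g v')"
      if "((u, v), (u', v')) \<in> parcs (direct_product G H)" for u v u' v'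
    proof -
      have arcs: "(u, u') \<in> parcs G" "(v, v') \<in> parcs H"
        using that by (auto simp: direct_product_def direct_edges_def)
      moreover have "g v \<noteq> g v'"
        using g(1) arcs(2) unfolding two_frugal_coloring_def proper_coloring_def by blast
      ultimately show ?thesis
        by (simp add: neighborhood_def)
    qed
  qed (use f(1) g(1) assms(2) G.pair_finite_verts in
    \<open>simp_all add: direct_product_def injective_coloring_def\<close>)
  then show ?thesis
    using f(2) g(2) by simp
qed

section \<open>Exchanging the factors\<close>

text \<open>
  A 2-frugal colouring pulls back along an injective homomorphism, since the neighborhood of
  a vertex is mapped injectively into the neighborhood of its image.
\<close>

lemma chi_2f_le_if_embedding:
  assumes G: "pair_graph G" and H: "pair_graph H"
    and inj: "inj_on \<phi> (pverts G)" and verts: "\<phi> ` pverts G \<subseteq> pverts H"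
    and arcs: "\<And>x y. (x, y) \<in> parcs G \<Longrightarrow> (\<phi> x, \<phi> y) \<in> parcs H"
  shows "chi_2f G \<le> chi_2f H"
proof -
  interpret G: pair_graph G by fact
  interpret H: pair_graph H by fact
  obtain f :: "_ \<Rightarrow> nat" where f: "two_frugal_coloring H f" "card (f ` pverts H) = chi_2f H"
    using H by (rule optimal_two_frugal_coloring)
  have "card {y \<in> neighborhood G x. (f \<circ> \<phi>) y = c} \<le> 2" if "x \<in> pverts G" for x c
  proof -
    have "card {y \<in> neighborhood G x. (f \<circ> \<phi>) y = c} \<le> card {z \<in> neighborhood H (\<phi> x). f z = c}"
    proof (rule card_inj_on_le)
      show "inj_on \<phi> {y \<in> neighborhood G x. (f \<circ> \<phi>) y = c}"
        using inj by (rule inj_on_subset) (auto simp: neighborhood_def dest: G.in_arcsD2)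
      show "\<phi> ` {y \<in> neighborhood G x. (f \<circ> \<phi>) y = c} \<subseteq> {z \<in> neighborhood H (\<phi> x). f z = c}"
        using arcs by (auto simp: neighborhood_def)
      show "finite {z \<in> neighborhood H (\<phi> x). f z = c}"
        using finite_neighborhood[OF H] by simp
    qed
    also have "\<dots> \<le> 2"
      using f(1) that verts by (auto simp: two_frugal_coloring_def)
    finally show ?thesis .
  qed
  moreover have "proper_coloring G (f \<circ> \<phi>)"
    using f(1) arcs by (auto simp: two_frugal_coloring_def proper_coloring_def)
  ultimately have "two_frugal_coloring G (f \<circ> \<phi>)"
    by (auto simp: two_frugal_coloring_def)
  then have "chi_2f G \<le> card ((f \<circ> \<phi>) ` pverts G)"
    unfolding chi_2f_def by (rule min_colors_le[of "two_frugal_coloring G"])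
  also have "\<dots> \<le> card (f ` pverts H)"
    using verts H.pair_finite_verts by (intro card_mono) auto
  finally show ?thesis
    using f(2) by simp
qed

lemma pair_graphI:
  assumes fin: "finite (pverts G)" and sub: "parcs G \<subseteq> pverts G \<times> pverts G"
    and "sym (parcs G)" and loopless: "\<And>u. (u, u) \<notin> parcs G"
  shows "pair_graph G"
proof
  show "finite (parcs G)"
    using sub fin by (auto intro: finite_subset)
  show "symmetric (with_proj G)"
    using assms(3) by (simp add: symmetric_def)
  show "fst e \<noteq> snd e" if "e \<in> parcs G" for e
    using that loopless by (cases e) auto
qed (use fin sub in auto)

lemma pair_graph_strong_product:
  assumes "pair_graph G" "pair_graph H"
  shows "pair_graph (strong_product G H)"
proof -
  interpret G: pair_graph G by fact
  interpret H: pair_graph H by fact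
  show ?thesis
  proof (rule pair_graphI)
    show "finite (pverts (strong_product G H))"
      by (simp add: strong_product_def G.pair_finite_verts H.pair_finite_verts)
    show "parcs (strong_product G H) \<subseteq> pverts (strong_product G H) \<times> pverts (strong_product G H)"
      by (auto simp: strong_product_def cartesian_edges_def direct_edges_def
          dest: G.in_arcsD1 G.in_arcsD2 H.in_arcsD1 H.in_arcsD2)
    show "sym (parcs (strong_product G H))"
      unfolding strong_product_def cartesian_edges_def direct_edges_def sym_def
      by clarsimp (blast dest: G.arcs_symmetric H.arcs_symmetric)
    show "(x, x) \<notin> parcs (strong_product G H)" for x
      by (cases x) (auto simp: strong_product_def cartesian_edges_def direct_edges_def
          dest: G.pair_no_loops H.pair_no_loops)
  qed
qed

lemma pair_graph_direct_product:
  assumes "pair_graph G" "pair_graph H"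
  shows "pair_graph (direct_product G H)"
proof -
  interpret G: pair_graph G by fact
  interpret H: pair_graph H by fact
  show ?thesis
  proof (rule pair_graphI)
    show "finite (pverts (direct_product G H))"
      by (simp add: direct_product_def G.pair_finite_verts H.pair_finite_verts)
    show "parcs (direct_product G H) \<subseteq> pverts (direct_product G H) \<times> pverts (direct_product G H)"
      by (auto simp: direct_product_def direct_edges_def
          dest: G.in_arcsD1 G.in_arcsD2 H.in_arcsD1 H.in_arcsD2)
    show "sym (parcs (direct_product G H))"
      unfolding direct_product_def direct_edges_def sym_def
      by clarsimp (blast dest: G.arcs_symmetric H.arcs_symmetric)
    show "(x, x) \<notin> parcs (direct_product G H)" for x
      by (cases x) (auto simp: direct_product_def direct_edges_def
          dest: G.pair_no_loops)
  qed
qed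

lemma chi_2f_strong_product_swap:
  assumes "pair_graph G" "pair_graph H"
  shows "chi_2f (strong_product G H) \<le> chi_2f (strong_product H G)"
  using assms
  by (intro chi_2f_le_if_embedding[where \<phi> = prod.swap] pair_graph_strong_product)
    (auto simp: strong_product_def cartesian_edges_def direct_edges_def)

lemma chi_2f_direct_product_swap:
  assumes "pair_graph G" "pair_graph H"
  shows "chi_2f (direct_product G H) \<le> chi_2f (direct_product H G)"
  using assms
  by (intro chi_2f_le_if_embedding[where \<phi> = prod.swap] pair_graph_direct_product)
    (auto simp: direct_product_def direct_edges_def)

lemma chi_2f_strong_product_le_min:
  assumes "pair_graph G" "pair_graph H"
  shows "chi_2f (strong_product G H) \<le> min (chi_2 G * chi_2f H) (chi_2 H * chi_2f G)"
  using chi_2f_strong_product_le[OF assms] chi_2f_strong_product_swap[OF assms]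
    chi_2f_strong_product_le[OF assms(2,1)] by simp

lemma chi_2f_direct_product_le_min:
  assumes "pair_graph G" "pair_graph H"
  shows "chi_2f (direct_product G H) \<le> min (chi_i G * chi_2f H) (chi_i H * chi_2f G)"
  using chi_2f_direct_product_le[OF assms] chi_2f_direct_product_swap[OF assms]
    chi_2f_direct_product_le[OF assms(2,1)] by simp

section \<open>Sharpness\<close>

definition K2 :: "nat pair_pre_digraph" where
  "K2 = \<lparr> pverts = {0, 1}, parcs = {(0, 1), (1, 0)} \<rparr>"

lemma pair_graph_K2: "pair_graph K2"
  by (rule pair_graphI) (auto simp: K2_def sym_def)

lemma connected_graph_K2: "connected_graph K2"
proof -
  interpret pair_graph K2
    by (rule pair_graph_K2)
  have edges: "parcs (mk_symmetric (with_proj K2)) = {(0, 1), (1, 0)}"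
    by (auto simp: parcs_mk_symmetric K2_def)
  interpret S: pair_wf_digraph "mk_symmetric (with_proj K2)" ..
  have "strongly_connected (mk_symmetric (with_proj K2))"
  proof (rule strongly_connectedI)
    fix u v
    assume u: "u \<in> verts (mk_symmetric (with_proj K2))"
      and v: "v \<in> verts (mk_symmetric (with_proj K2))"
    show "u \<rightarrow>\<^sup>*\<^bsub>mk_symmetric (with_proj K2)\<^esub> v"
    proof (cases "u = v")
      case True
      then show ?thesis
        using u by (simp add: S.reachable_refl)
    next
      case False
      then have "(u, v) \<in> parcs (mk_symmetric (with_proj K2))"
        using u v unfolding edges by (auto simp: K2_def)
      then show ?thesis
        by (rule S.reachable_adjI)
    qed
  qed (simp add: K2_def)
  then show ?thesis
    by (simp add: connected_graph_def connected_def pair_graph_K2)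
qed

lemma chi_K2_le: "chi_2f K2 \<le> 2" "chi_2 K2 \<le> 2" "chi_i K2 \<le> 1"
proof -
  have id: "card ((\<lambda>x. x) ` pverts K2) = 2"
    by (simp add: K2_def)
  have "two_frugal_coloring K2 (\<lambda>x. x)" "two_distance_coloring K2 (\<lambda>x. x)"
    by (auto intro: two_frugal_coloring_if_inj two_distance_coloring_if_inj pair_graph_K2)
  then show "chi_2f K2 \<le> 2" "chi_2 K2 \<le> 2"
    unfolding chi_2f_def chi_2_def using min_colors_le id by metis+
  have "injective_coloring K2 (\<lambda>_. 0 :: nat)"
    by (auto simp: injective_coloring_def neighborhood_def K2_def)
  then have "chi_i K2 \<le> card ((\<lambda>_. 0 :: nat) ` pverts K2)"
    unfolding chi_i_def by (rule min_colors_le)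
  then show "chi_i K2 \<le> 1"
    by (simp add: K2_def)
qed

text \<open>A proper colouring is injective on a clique.\<close>

lemma card_clique_le_chi_2f:
  assumes "pair_graph G" and C: "C \<subseteq> pverts G"
    and clique: "\<And>x y. x \<in> C \<Longrightarrow> y \<in> C \<Longrightarrow> x \<noteq> y \<Longrightarrow> (x, y) \<in> parcs G"
  shows "card C \<le> chi_2f G"
proof -
  interpret pair_graph G by fact
  obtain f :: "_ \<Rightarrow> nat" where f: "two_frugal_coloring G f" "card (f ` pverts G) = chi_2f G"
    using assms(1) by (rule optimal_two_frugal_coloring)
  have "inj_on f C"
    using f(1) clique by (fastforce simp: inj_on_def two_frugal_coloring_def proper_coloring_def)
  then have "card C \<le> card (f ` pverts G)"
    using C pair_finite_verts by (intro card_inj_on_le[where f = f]) auto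
  then show ?thesis
    using f(2) by simp
qed

lemma chi_2f_strong_product_K2: "4 \<le> chi_2f (strong_product K2 K2)"
proof -
  have "card ({0, 1} \<times> {0, 1} :: (nat \<times> nat) set) \<le> chi_2f (strong_product K2 K2)"
    by (rule card_clique_le_chi_2f[OF pair_graph_strong_product[OF pair_graph_K2 pair_graph_K2]])
      (auto simp: strong_product_def cartesian_edges_def direct_edges_def K2_def)
  then show ?thesis
    by (simp add: card_cartesian_product)
qed

lemma chi_2f_direct_product_K2: "2 \<le> chi_2f (direct_product K2 K2)"
proof -
  have "card {(0, 0), (1, 1) :: nat \<times> nat} \<le> chi_2f (direct_product K2 K2)"
    by (rule card_clique_le_chi_2f[OF pair_graph_direct_product[OF pair_graph_K2 pair_graph_K2]])
      (auto simp: direct_product_def direct_edges_def K2_def)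
  then show ?thesis
    by simp
qed

theorem theorem6p5:
  shows
    "(\<forall>(G :: 'a pair_pre_digraph) (H :: 'b pair_pre_digraph).
       connected_graph G \<and> connected_graph H \<longrightarrow>
       chi_2f (strong_product G H) \<le> min (chi_2 G * chi_2f H) (chi_2 H * chi_2f G) \<and>
       chi_2f (direct_product G H) \<le> min (chi_i G * chi_2f H) (chi_i H * chi_2f G)) \<and>
     (\<exists>(G :: nat pair_pre_digraph) (H :: nat pair_pre_digraph).
       connected_graph G \<and> connected_graph H \<and>
       chi_2f (strong_product G H) = min (chi_2 G * chi_2f H) (chi_2 H * chi_2f G)) \<and>
     (\<exists>(G :: nat pair_pre_digraph) (H :: nat pair_pre_digraph).
       connected_graph G \<and> connected_graph H \<and>
       chi_2f (direct_product G H) = min (chi_i G * chi_2f H) (chi_i H * chi_2f G))"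
proof (intro conjI allI impI)
  fix G :: "'a pair_pre_digraph" and H :: "'b pair_pre_digraph"
  assume "connected_graph G \<and> connected_graph H"
  then have GH: "pair_graph G" "pair_graph H"
    by (auto simp: connected_graph_def)
  show "chi_2f (strong_product G H) \<le> min (chi_2 G * chi_2f H) (chi_2 H * chi_2f G)"
    using GH by (rule chi_2f_strong_product_le_min)
  show "chi_2f (direct_product G H) \<le> min (chi_i G * chi_2f H) (chi_i H * chi_2f G)"
    using GH by (rule chi_2f_direct_product_le_min)
next
  have "chi_2 K2 * chi_2f K2 \<le> 2 * 2"
    using chi_K2_le by (intro mult_le_mono)
  then have "chi_2f (strong_product K2 K2) = min (chi_2 K2 * chi_2f K2) (chi_2 K2 * chi_2f K2)"
    using chi_2f_strong_product_le_min[OF pair_graph_K2 pair_graph_K2] chi_2f_strong_product_K2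
    by simp
  then show "\<exists>(G :: nat pair_pre_digraph) (H :: nat pair_pre_digraph).
      connected_graph G \<and> connected_graph H \<and>
      chi_2f (strong_product G H) = min (chi_2 G * chi_2f H) (chi_2 H * chi_2f G)"
    using connected_graph_K2 by blast
next
  have "chi_i K2 * chi_2f K2 \<le> 1 * 2"
    using chi_K2_le by (intro mult_le_mono)
  then have "chi_2f (direct_product K2 K2) = min (chi_i K2 * chi_2f K2) (chi_i K2 * chi_2f K2)"
    using chi_2f_direct_product_le_min[OF pair_graph_K2 pair_graph_K2] chi_2f_direct_product_K2
    by simp
  then show "\<exists>(G :: nat pair_pre_digraph) (H :: nat pair_pre_digraph).
      connected_graph G \<and> connected_graph H \<and>
      chi_2f (direct_product G H) = min (chi_i G * chi_2f H) (chi_i H * chi_2f G)"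
    using connected_graph_K2 by blast
qed

end
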